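(* Let $\gamma$ be the Gaussian measure with density $\frac{1}{\sqrt{2\pi}}e^{-x^2/2}$ on $\mathbb{R}$. Let $f:\mathbb{R}\to[0,\infty)$ be a log-subharmonic $\mathcal{C}^1$ function such that $f\in L^1(\gamma)$, $Ef\in L^1(\gamma)$ and $\int f|\log f|\,d\gamma<\infty$, where $Ef(x)=xf'(x)$. Then $$\int f\log f\,d\gamma-\|f\|_{1,\gamma}\log\|f\|_{1,\gamma}\le\frac12\int Ef\,d\gamma.$$
   Context: On $\mathbb{R}$, a function $f:\mathbb{R}\to[0,\infty)$ is log-subharmonic if $\log f$ is subharmonic: upper semicontinuous with values in $[-\infty,\infty)$, locally integrable, not identically $-\infty$, and satisfying $\log f(x)\le\frac12(\log f(x+y)+\log f(x-y))$ for all $x,y\in\mathbb{R}$; equivalently, $f>0$ and $\log f$ is convex. $\|f\|_{1,\gamma}=\int |f|\,d\gamma$. *)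

theory Defs
  imports "HOL-Probability.Probability"
begin

definition gaussian :: "real measure" where
  "gaussian = density lborel (\<lambda>x. ennreal (std_normal_density x))"

definition L1_norm :: "'a measure \<Rightarrow> ('a \<Rightarrow> real) \<Rightarrow> real" where
  "L1_norm M f = (\<integral>x. \<bar>f x\<bar> \<partial>M)"

text \<open>The logarithm on \<open>[0,\<infinity>)\<close> with values in \<open>[-\<infinity>,\<infinity>)\<close>; the library's
  \<^const>\<open>ln\<close> on \<^typ>\<open>real\<close> has the junk value \<open>ln 0 = 0\<close>.  Values at negative
  arguments are irrelevant.\<close>

definition elog :: "real \<Rightarrow> ereal" where
  "elog t = (if t > 0 then ereal (ln t) else -\<infinity>)"

definition upper_semicontinuous :: "(real \<Rightarrow> ereal) \<Rightarrow> bool" where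
  "upper_semicontinuous u \<longleftrightarrow> (\<forall>x. Limsup (at x) u \<le> u x)"

definition locally_integrable :: "(real \<Rightarrow> ereal) \<Rightarrow> bool" where
  "locally_integrable u \<longleftrightarrow>
     u \<in> borel_measurable lborel \<and>
     (\<forall>K. compact K \<longrightarrow> (\<integral>\<^sup>+x\<in>K. e2ennreal \<bar>u x\<bar> \<partial>lborel) < \<infinity>)"

definition subharmonic :: "(real \<Rightarrow> ereal) \<Rightarrow> bool" where
  "subharmonic u \<longleftrightarrow>
     (\<forall>x. u x < \<infinity>) \<and>
     upper_semicontinuous u \<and>
     locally_integrable u \<and>
     (\<exists>x. u x \<noteq> -\<infinity>) \<and>
     (\<forall>x y. u x \<le> (u (x + y) + u (x - y)) / 2)"

definition log_subharmonic :: "(real \<Rightarrow> real) \<Rightarrow> bool" where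
  "log_subharmonic f \<longleftrightarrow> (\<forall>x. 0 \<le> f x) \<and> subharmonic (\<lambda>x. elog (f x))"

definition euler_op :: "(real \<Rightarrow> real) \<Rightarrow> real \<Rightarrow> real" where
  "euler_op f x = x * deriv f x"

end

theory Submission
  imports Defs
begin

text \<open>Write \<open>\<phi>\<close> for the Gaussian density, \<open>Z = \<integral>f d\<gamma>\<close>, \<open>g = f \<phi> / Z\<close> and \<open>\<mu> = f \<gamma> / Z\<close>,
  and let \<open>T\<close> be the increasing map that transports \<open>\<mu>\<close> to \<open>\<gamma>\<close>.  Since \<open>ln f\<close> is convex, \<open>g\<close>
  dominates a multiple of a shifted Gaussian that touches it at any given point, and comparing tails gives
  \<open>T' \<le> 1\<close>, that is \<open>g \<le> \<phi> \<circ> T\<close>, or \<open>ln (f x / Z) \<le> x\<^sup>2 / 2 - (T x)\<^sup>2 / 2\<close>.  Integrating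
  against \<open>\<mu>\<close> and using \<open>\<integral>T\<^sup>2 d\<mu> = \<integral>x\<^sup>2 d\<gamma> = 1\<close> bounds the entropy by
  \<open>1/2 \<integral>f (x\<^sup>2 - 1) d\<gamma>\<close>, which is at most \<open>1/2 \<integral>x f' d\<gamma>\<close> by partial integration, the boundary
  terms having the favourable sign.\<close>

section \<open>Positivity of \<open>f\<close> and tangent bounds for \<open>ln f\<close>\<close>

text \<open>A zero at \<open>x\<close> spreads: every \<open>z\<close> is the midpoint of
  \<open>x\<close> and its reflection \<open>z + (z - x)\<close>, so the midpoint inequality makes
  \<open>elog (f z)\<close> equal to \<open>-\<infinity>\<close> for all \<open>z\<close>, which
  \<open>subharmonic\<close> excludes.\<close>

lemma elog_pos_of_subharmonic:
  assumes "subharmonic (\<lambda>x. elog (f x))"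
  shows "f x > 0"
proof (rule ccontr)
  assume "\<not> f x > 0"
  then have x: "elog (f x) = -\<infinity>" by (simp add: elog_def)
  obtain z where z: "elog (f z) \<noteq> -\<infinity>" using assms unfolding subharmonic_def by blast
  have "elog (f z) \<le> (elog (f (z + (z - x))) + elog (f (z - (z - x)))) / 2"
    using assms unfolding subharmonic_def by blast
  also have "z - (z - x) = x" by simp
  also have "elog (f (z + (z - x))) + elog (f x) = -\<infinity>"
    unfolding x by (simp add: elog_def)
  finally show False using z by (simp add: ereal_divide_eq)
qed

lemma ln_midpoint_convex_of_subharmonic:
  assumes "subharmonic (\<lambda>x. elog (f x))"
  shows "2 * ln (f x) \<le> ln (f (x + y)) + ln (f (x - y))"
proof -
  have "elog (f x) \<le> (elog (f (x + y)) + elog (f (x - y))) / 2"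
    using assms unfolding subharmonic_def by blast
  then have "ereal (ln (f x)) \<le> (ereal (ln (f (x + y))) + ereal (ln (f (x - y)))) / ereal 2"
    by (simp add: elog_def elog_pos_of_subharmonic[OF assms])
  then show ?thesis by (simp add: numeral_eq_ereal)
qed

text \<open>Halving the step: the midpoint inequality on \<open>x\<close> and \<open>x + e n\<close>
  shows that \<open>2 ^ n * (u (x + e n) - u x)\<close> does not increase with \<open>n\<close>. It
  starts at \<open>u (x + h) - u x\<close> and tends to \<open>a * h\<close> by
  differentiability.\<close>

lemma midpoint_convex_above_tangent:
  fixes u :: "real \<Rightarrow> real"
  assumes mid: "\<And>x y. 2 * u x \<le> u (x + y) + u (x - y)"
    and d: "(u has_real_derivative a) (at x)"
  shows "u x + a * h \<le> u (x + h)"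
proof (cases "h = 0")
  case False
  define e where "e n = h / 2 ^ n" for n :: nat
  have "2 ^ n * (u (x + e n) - u x) \<le> u (x + h) - u x" for n
  proof (induction n)
    case (Suc n)
    have "e n = 2 * e (Suc n)" by (simp add: e_def)
    then have "2 * u (x + e (Suc n)) \<le> u (x + e n) + u x"
      using mid[of "x + e (Suc n)" "e (Suc n)"] by (simp add: algebra_simps)
    then have "2 * (u (x + e (Suc n)) - u x) \<le> u (x + e n) - u x" by simp
    then have "2 ^ n * (2 * (u (x + e (Suc n)) - u x)) \<le> 2 ^ n * (u (x + e n) - u x)"
      by (intro mult_left_mono) auto
    then show ?case using Suc by (simp add: algebra_simps)
  qed (simp add: e_def)
  moreover have "2 ^ n * (u (x + e n) - u x) = h * ((u (x + e n) - u x) / e n)" for n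
    using False by (simp add: e_def)
  ultimately have le: "h * ((u (x + e n) - u x) / e n) \<le> u (x + h) - u x" for n by simp
  have "e \<longlonglongrightarrow> 0" unfolding e_def by (rule LIMSEQ_divide_realpow_zero) simp
  moreover have "e n \<noteq> 0" for n using False by (simp add: e_def)
  ultimately have "filterlim e (at 0) sequentially" by (simp add: filterlim_at)
  from filterlim_compose[OF d[unfolded DERIV_def] this]
  have "(\<lambda>n. h * ((u (x + e n) - u x) / e n)) \<longlonglongrightarrow> h * a" by (rule tendsto_mult_left)
  then have "h * a \<le> u (x + h) - u x" by (rule LIMSEQ_le_const2) (use le in auto)
  then show ?thesis by (simp add: mult.commute)
qed simp

lemma log_subharmonic_above_exp_tangent:
  assumes "log_subharmonic f" and d: "(f has_real_derivative D) (at x)"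
  shows "f x * exp (D / f x * h) \<le> f (x + h)"
proof -
  have s: "subharmonic (\<lambda>x. elog (f x))" using assms by (simp add: log_subharmonic_def)
  note pos = elog_pos_of_subharmonic[OF s]
  have "((\<lambda>x. ln (f x)) has_real_derivative D / f x) (at x)"
    by (rule derivative_eq_intros d refl pos)+ simp
  from midpoint_convex_above_tangent[OF ln_midpoint_convex_of_subharmonic[OF s] this]
  have "ln (f x) + D / f x * h \<le> ln (f (x + h))" .
  then have "exp (ln (f x) + D / f x * h) \<le> exp (ln (f (x + h)))" by simp
  then show ?thesis using pos by (simp add: exp_add)
qed

section \<open>Comparing tails with the Gaussian\<close>

text \<open>The sign \<open>c\<close> handles both tails at once: \<open>c = 1\<close> gives the
  half-line right of \<open>x\<close>, \<open>c = - 1\<close> the one left of it. The substitution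
  \<open>y \<mapsto> x + c * y\<close> carries either to \<open>{0<..}\<close>.\<close>

lemma measure_density_half_line:
  fixes g :: "real \<Rightarrow> real"
  assumes [measurable]: "g \<in> borel_measurable borel" and g: "integrable lborel g"
    and nn: "\<And>x. 0 \<le> g x" and c: "\<bar>c\<bar> = 1"
  shows "measure (density lborel g) {y. 0 < c * (y - x)} = (\<integral>y. indicator {0<..} y * g (x + c * y) \<partial>lborel)"
    and "integrable lborel (\<lambda>y. indicator {0<..} y * g (x + c * y))"
proof -
  have cc: "c * c = 1" using c by (auto simp: abs_if split: if_splits)
  have ind: "integrable lborel (\<lambda>y. indicator {y. 0 < c * (y - x)} y * g y)"
    using integrable_real_mult_indicator[OF _ g, of "{y. 0 < c * (y - x)}"] by (simp add: mult.commute)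
  have shift: "indicator {y. 0 < c * (y - x)} (x + c * y) = (indicator {0<..} y :: real)" for y
    using cc by (simp add: indicator_def mult.assoc[symmetric])
  have "emeasure (density lborel g) {y. 0 < c * (y - x)}
      = ennreal (\<integral>y. indicator {y. 0 < c * (y - x)} y * g y \<partial>lborel)"
    using ind nn by (subst emeasure_density)
      (auto simp: nn_integral_eq_integral[symmetric] ennreal_mult mult.commute
        intro!: nn_integral_cong split: split_indicator)
  then have "measure (density lborel g) {y. 0 < c * (y - x)}
      = (\<integral>y. indicator {y. 0 < c * (y - x)} y * g y \<partial>lborel)"
    unfolding measure_def using nn by (simp add: integral_nonneg_AE)
  also have "\<dots> = (\<integral>y. indicator {0<..} y * g (x + c * y) \<partial>lborel)"
    using c by (subst lborel_integral_real_affine[where c = c and t = x]) (auto simp: shift)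
  finally show "measure (density lborel g) {y. 0 < c * (y - x)} = (\<integral>y. indicator {0<..} y * g (x + c * y) \<partial>lborel)" .
  show "integrable lborel (\<lambda>y. indicator {0<..} y * g (x + c * y))"
    using lborel_integrable_real_affine[OF ind, of c x] c by (auto simp: shift)
qed

lemma std_normal_density_shift:
  "std_normal_density (t + h) = std_normal_density t * exp (- t * h - h\<^sup>2 / 2)"
  by (simp add: std_normal_density_def exp_add[symmetric] field_simps power2_eq_square)

text \<open>The Mills-type ratio: the tails of \<open>\<gamma>\<close> at \<open>t\<close> are \<open>\<phi>(t) mills (- t)\<close> and
  \<open>\<phi>(t) mills t\<close>, where \<open>\<phi>\<close> is the Gaussian density.\<close>

definition mills :: "real \<Rightarrow> real" where
  "mills s = (\<integral>y. indicator {0<..} y * exp (- s * y - y\<^sup>2 / 2) \<partial>lborel)"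

text \<open>The integrand is the Gaussian density at \<open>s + y\<close> divided by its value at
  \<open>s\<close>, restricted to a half-line.\<close>

lemma integrable_mills:
  fixes s :: real
  shows "integrable lborel (\<lambda>y. indicator {0<..} y * exp (- s * y - y\<^sup>2 / 2))"
proof -
  have "integrable lborel (\<lambda>y. indicator {0<..} y * std_normal_density (s + 1 * y))"
    by (rule measure_density_half_line) auto
  then have "integrable lborel (\<lambda>y. (indicator {0<..} y * std_normal_density (s + 1 * y)) / std_normal_density s)"
    by (rule integrable_divide_zero)
  moreover have "std_normal_density s > 0" by (simp add: normal_density_pos)
  ultimately show ?thesis by (simp add: std_normal_density_shift)
qed

lemma mills_antimono: "s \<le> t \<Longrightarrow> mills t \<le> mills s"
  unfolding mills_def
  by (intro integral_mono integrable_mills) (auto intro!: mult_right_mono split: split_indicator)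

lemma mills_pos: "0 < mills s"
proof -
  have "mills s \<noteq> 0"
  proof
    assume "mills s = 0"
    then have "AE y in lborel. indicator {0<..} y * exp (- s * y - y\<^sup>2 / 2) = 0"
      unfolding mills_def by (subst (asm) integral_nonneg_eq_0_iff_AE[OF integrable_mills]) auto
    \<comment> \<open>The exponential never vanishes, so the indicator must; any nonempty interval
      in \<open>{0<..}\<close> would do.\<close>
    then have "AE y in lborel. y \<notin> {0<..<1::real}"
      by eventually_elim (auto split: split_indicator_asm)
    then have "{0<..<1::real} \<in> null_sets lborel" by (subst AE_iff_null_sets) auto
    then show False by (auto simp: null_sets_def)
  qed
  moreover have "0 \<le> mills s" unfolding mills_def by (intro integral_nonneg_AE) auto
  ultimately show ?thesis by simp
qed

lemma gaussian_half_line: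
  assumes "\<bar>c\<bar> = 1"
  shows "measure gaussian {y. 0 < c * (y - t)} = std_normal_density t * mills (c * t)"
proof -
  have cc: "c\<^sup>2 = 1" using assms by (auto simp: abs_if power2_eq_square split: if_splits)
  have "measure gaussian {y. 0 < c * (y - t)}
      = (\<integral>y. std_normal_density t * (indicator {0<..} y * exp (- (c * t) * y - y\<^sup>2 / 2)) \<partial>lborel)"
    unfolding gaussian_def using assms cc
    by (subst measure_density_half_line)
       (auto simp: std_normal_density_shift power_mult_distrib ac_simps)
  then show ?thesis by (simp add: mills_def)
qed

text \<open>A density that dominates a multiple of a shifted Gaussian agreeing with it at \<open>x\<close> has, for
  given tail probabilities at \<open>x\<close>, a smaller value at \<open>x\<close> than the Gaussian.\<close>

lemma density_le_std_normal_density: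
  fixes g :: "real \<Rightarrow> real"
  assumes [measurable]: "g \<in> borel_measurable borel" and g: "integrable lborel g"
    and nn: "\<And>x. 0 \<le> g x"
    and tangent: "\<And>h. g x * exp (- s * h - h\<^sup>2 / 2) \<le> g (x + h)"
    and lower: "measure (density lborel g) {..<x} = measure gaussian {..<t}"
    and upper: "measure (density lborel g) {x<..} = measure gaussian {t<..}"
  shows "g x \<le> std_normal_density t"
proof -
  \<comment> \<open>Integrate \<open>tangent\<close> over one side of \<open>x\<close>. Its left
    side is a multiple of the Gaussian density at \<open>s + h\<close>, so the tail of the minorant
    is a \<open>mills\<close> value.\<close>
  have tail: "g x * mills (c * s) \<le> measure (density lborel g) {y. 0 < c * (y - x)}" if c: "\<bar>c\<bar> = 1" for c
  proof -
    have cc: "c\<^sup>2 = 1" using c by (auto simp: abs_if power2_eq_square split: if_splits)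
    have "g x * mills (c * s) = (\<integral>y. g x * (indicator {0<..} y * exp (- (c * s) * y - y\<^sup>2 / 2)) \<partial>lborel)"
      by (simp add: mills_def)
    also have "\<dots> \<le> (\<integral>y. indicator {0<..} y * g (x + c * y) \<partial>lborel)"
    proof (rule integral_mono)
      show "g x * (indicator {0<..} y * exp (- (c * s) * y - y\<^sup>2 / 2)) \<le> indicator {0<..} y * g (x + c * y)" for y
        using tangent[of "c * y"] cc by (auto simp: power_mult_distrib ac_simps split: split_indicator)
    qed (use integrable_mills measure_density_half_line(2)[OF assms(1) g nn c] in auto)
    also have "\<dots> = measure (density lborel g) {y. 0 < c * (y - x)}"
      using measure_density_half_line(1)[OF assms(1) g nn c] by simp
    finally show ?thesis .
  qed
  have cmp: "g x \<le> std_normal_density t"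
    if c: "\<bar>c\<bar> = 1" and ts: "c * s \<le> c * t"
      and eq: "measure (density lborel g) {y. 0 < c * (y - x)} = measure gaussian {y. 0 < c * (y - t)}" for c
  proof -
    have "g x * mills (c * s) \<le> std_normal_density t * mills (c * t)"
      using tail[OF c] unfolding eq gaussian_half_line[OF c] .
    also have "\<dots> \<le> std_normal_density t * mills (c * s)"
      using mills_antimono[OF ts] by (intro mult_left_mono) auto
    finally show ?thesis using mills_pos by simp
  qed
  have up: "{y. 0 < 1 * (y - a)} = {a<..}" and lo: "{y. 0 < - 1 * (y - a)} = {..<a}" for a :: real by auto
  show ?thesis
  \<comment> \<open>Since \<open>mills\<close> decreases, the right tails decide when
    \<open>s \<le> t\<close>, and the left tails, with arguments \<open>- s\<close> and
    \<open>- t\<close>, otherwise.\<close>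
  proof (cases "s \<le> t")
    case True
    show ?thesis by (rule cmp[of 1]) (simp_all only: up upper, use True in simp_all)
  next
    case False
    show ?thesis by (rule cmp[of "- 1"]) (simp_all only: lo lower, use False in simp_all)
  qed
qed

section \<open>Distribution functions and monotone transport\<close>

locale continuous_cdf = real_distribution +
  assumes no_atoms: "measure M {x} = 0"
begin

lemma continuous_on_cdf: "continuous_on S (cdf M)"
  using isCont_cdf no_atoms by (intro continuous_at_imp_continuous_on) auto

lemma cdf_surj:
  assumes "0 < p" "p < 1"
  shows "\<exists>x. cdf M x = p"
proof -
  have "\<forall>\<^sub>F x in at_bot. cdf M x < p"
    using order_tendstoD(2)[OF cdf_lim_at_bot] assms by auto
  then obtain a where a: "cdf M a < p" by (auto simp: eventually_at_bot_linorder)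
  have "\<forall>\<^sub>F x in at_top. p < cdf M x"
    using order_tendstoD(1)[OF cdf_lim_at_top_prob] assms by auto
  then obtain b where b: "p < cdf M b" by (auto simp: eventually_at_top_linorder)
  have "a \<le> b" using a b cdf_nondecreasing[of b a] by linarith
  then show ?thesis using IVT'[of "cdf M" a p b] a b continuous_on_cdf by auto
qed

lemma measure_lessThan: "measure M {..<x} = cdf M x"
proof -
  have "measure M {..x} = measure M {..<x} + measure M {x}"
    by (subst finite_measure_Union[symmetric]) (auto intro: arg_cong[where f = "measure M"])
  then show ?thesis using no_atoms by (simp add: cdf_def)
qed

lemma measure_greaterThan: "measure M {x<..} = 1 - cdf M x"
proof -
  have "{x<..} = space M - {..x}" by auto
  then show ?thesis using prob_compl[of "{..x}"] by (simp add: cdf_def)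
qed

end

text \<open>With both conditions the distribution function is an increasing bijection onto the open
  unit interval, so it can be inverted.\<close>

locale strict_cdf = continuous_cdf +
  assumes interval_pos: "a < b \<Longrightarrow> 0 < measure M {a<..b}"
begin

lemma cdf_strict_mono: "x < y \<Longrightarrow> cdf M x < cdf M y"
  using cdf_diff_eq[of x y] interval_pos[of x y] by linarith

lemma cdf_le_iff: "cdf M x \<le> cdf M y \<longleftrightarrow> x \<le> y"
  using cdf_strict_mono[of y x] cdf_nondecreasing[of x y] by linarith

lemma cdf_bounds: "0 < cdf M x" "cdf M x < 1"
  using cdf_strict_mono[of "x - 1" x] cdf_nonneg[of "x - 1"]
    cdf_strict_mono[of x "x + 1"] cdf_bounded_prob[of "x + 1"] by auto

end

text \<open>\<open>T\<close> is the distribution function of \<open>M\<close> followed by the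
  inverse of that of \<open>N\<close>. It is increasing, hence measurable.\<close>

lemma cdf_transport:
  assumes "strict_cdf M" "strict_cdf N"
  obtains T where "T \<in> borel_measurable borel" "\<And>x. cdf N (T x) = cdf M x" "distr M borel T = N"
proof -
  interpret M: strict_cdf M by fact
  interpret N: strict_cdf N by fact
  have "\<exists>T. \<forall>x. cdf N (T x) = cdf M x" using N.cdf_surj M.cdf_bounds by (intro choice) auto
  then obtain T where T: "cdf N (T x) = cdf M x" for x by blast
  have le: "T x \<le> T y \<longleftrightarrow> x \<le> y" for x y by (metis M.cdf_le_iff N.cdf_le_iff T)
  then have T_meas [measurable]: "T \<in> borel_measurable borel"
    by (intro borel_measurable_mono monoI) auto
  have "cdf (distr M borel T) t = cdf N t" for t
  proof -
    obtain x where x: "cdf M x = cdf N t" using M.cdf_surj N.cdf_bounds by blast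
    \<comment> \<open>The preimage of \<open>{..t}\<close> is thus the half-line ending at
      \<open>x\<close>, whose \<open>M\<close>-mass is \<open>cdf N t\<close> by the choice of
      \<open>x\<close>.\<close>
    have "T y \<le> t \<longleftrightarrow> y \<le> x" for y by (metis M.cdf_le_iff N.cdf_le_iff T x)
    then have "T -` {..t} \<inter> space M = {..x}" by auto
    then show ?thesis using x by (simp add: cdf_def measure_distr)
  qed
  then have "distr M borel T = N"
    by (intro cdf_unique M.real_distribution_distr N.real_distribution_axioms) (auto simp: fun_eq_iff)
  with T_meas T show ?thesis by (rule that)
qed

text \<open>A positive density has the same null sets as Lebesgue measure: points are null,
  nondegenerate intervals are not.\<close>

lemma strict_cdf_density:
  fixes g :: "real \<Rightarrow> real"
  assumes [measurable]: "g \<in> borel_measurable borel" and pos: "\<And>x. 0 < g x"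
    and "prob_space (density lborel g)"
  shows "strict_cdf (density lborel g)"
proof -
  interpret prob_space "density lborel g" by fact
  have null: "A \<in> null_sets (density lborel g) \<longleftrightarrow> A \<in> null_sets lborel" if "A \<in> sets borel" for A
    using that pos by (subst null_sets_density_iff) (auto simp: AE_iff_null_sets less_le)
  interpret real_distribution "density lborel g" by unfold_locales auto
  show ?thesis
  proof
    show "measure (density lborel g) {x} = 0" for x
      using null[of "{x}"] by (auto simp: null_sets_def measure_def)
    show "0 < measure (density lborel g) {a<..b}" if "a < b" for a b
      using null[of "{a<..b}"] that
      by (auto simp: null_sets_def emeasure_eq_measure zero_less_measure_iff)
  qed
qed

section \<open>Gaussian integrals and partial integration\<close>

lemma integrable_gaussian_iff:
  assumes [measurable]: "h \<in> borel_measurable borel"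
  shows "integrable gaussian h \<longleftrightarrow> integrable lborel (\<lambda>x. std_normal_density x * h x)"
  unfolding gaussian_def by (subst integrable_density) auto

lemma integral_gaussian:
  fixes h :: "real \<Rightarrow> real"
  assumes [measurable]: "h \<in> borel_measurable borel"
  shows "(\<integral>x. h x \<partial>gaussian) = (\<integral>x. std_normal_density x * h x \<partial>lborel)"
  unfolding gaussian_def by (subst integral_density) auto

lemma strict_cdf_gaussian: "strict_cdf gaussian"
  unfolding gaussian_def
  by (rule strict_cdf_density) (auto intro: prob_space_normal_density normal_density_pos)

lemma gaussian_second_moment:
  "integrable gaussian (\<lambda>x. x\<^sup>2)" "(\<integral>x. x\<^sup>2 \<partial>gaussian) = 1"
  using integrable_std_normal_moment[of 2] integral_std_normal_moment_even[of 1]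
  by (simp_all add: integrable_gaussian_iff integral_gaussian)

text \<open>On \<open>[-n, n]\<close> the integral of \<open>p - q\<close> is
  \<open>F n - F (- n)\<close>, which is nonnegative, so the integrals of \<open>q\<close> are
  bounded by those of \<open>p\<close>. Monotone convergence for \<open>q\<close> and dominated
  convergence for \<open>p\<close> yield both claims.\<close>

lemma integrable_of_FTC:
  fixes p q F :: "real \<Rightarrow> real"
  assumes p: "integrable lborel p" "continuous_on UNIV p"
    and q: "\<And>x. 0 \<le> q x" "continuous_on UNIV q"
    and F: "\<And>x. (F has_real_derivative p x - q x) (at x)"
    and boundary: "\<And>r. 0 \<le> r \<Longrightarrow> F (- r) \<le> F r"
  shows "integrable lborel q" and "(\<integral>x. q x \<partial>lborel) \<le> (\<integral>x. p x \<partial>lborel)"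
proof -
  define I :: "nat \<Rightarrow> real \<Rightarrow> real" where "I n x = indicator {- real n..real n} x" for n :: nat and x :: real
  have cont: "continuous_on S p" "continuous_on S q" for S
    using p q by (auto intro: continuous_on_subset)
  have [measurable]: "p \<in> borel_measurable borel" "q \<in> borel_measurable borel"
    using p q by (auto intro: borel_measurable_continuous_onI)
  have Ip: "integrable lborel (\<lambda>x. I n x * p x)" and Iq: "integrable lborel (\<lambda>x. I n x * q x)" for n
    using borel_integrable_compact[OF compact_Icc cont(1), of "- real n" "real n"]
      borel_integrable_compact[OF compact_Icc cont(2), of "- real n" "real n"]
    by (simp_all add: I_def)
  have lim: "(\<lambda>n. I n x * h x) \<longlonglongrightarrow> h x" for x and h :: "real \<Rightarrow> real"
  proof (rule tendsto_eventually)
    show "\<forall>\<^sub>F n in sequentially. I n x * h x = h x"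
      using eventually_ge_at_top[of "nat \<lceil>\<bar>x\<bar>\<rceil>"]
      by eventually_elim (auto simp: I_def indicator_def nat_le_iff ceiling_le_iff)
  qed
  have le: "(\<integral>x. I n x * q x \<partial>lborel) \<le> (\<integral>x. I n x * p x \<partial>lborel)" for n
  proof -
    have "(\<integral>x. I n x *\<^sub>R (p x - q x) \<partial>lborel) = F (real n) - F (- real n)"
      unfolding I_def using F
      by (intro integral_FTC_atLeastAtMost continuous_intros cont)
         (auto simp: has_real_derivative_iff_has_vector_derivative intro: has_vector_derivative_at_within)
    then have "(\<integral>x. I n x * p x \<partial>lborel) - (\<integral>x. I n x * q x \<partial>lborel) = F (real n) - F (- real n)"
      using Ip Iq by (simp add: right_diff_distrib)
    then show ?thesis using boundary[of "real n"] by simp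
  qed
  have lim_p: "(\<lambda>n. \<integral>x. I n x * p x \<partial>lborel) \<longlonglongrightarrow> (\<integral>x. p x \<partial>lborel)"
    using p lim
    by (intro integral_dominated_convergence[where w = "\<lambda>x. \<bar>p x\<bar>"])
       (auto simp: I_def indicator_def)
  have mono: "I m x * q x \<le> I n x * q x" if "m \<le> n" for m n x
    using that q(1)[of x] by (auto simp: I_def indicator_def)
  have "incseq (\<lambda>n. \<integral>x. I n x * q x \<partial>lborel)"
    by (intro incseq_SucI integral_mono Iq mono) auto
  moreover have "(\<integral>x. I n x * q x \<partial>lborel) \<le> (\<integral>x. \<bar>p x\<bar> \<partial>lborel)" for n
  proof -
    have "(\<integral>x. I n x * p x \<partial>lborel) \<le> (\<integral>x. \<bar>p x\<bar> \<partial>lborel)"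
      using p Ip by (intro integral_mono) (auto simp: I_def indicator_def)
    then show ?thesis using le[of n] by linarith
  qed
  ultimately obtain L where L: "(\<lambda>n. \<integral>x. I n x * q x \<partial>lborel) \<longlonglongrightarrow> L"
    using incseq_convergent by metis
  have "has_bochner_integral lborel q L"
    using Iq mono lim L
    by (intro has_bochner_integral_monotone_convergence) (auto simp: mono_def)
  then show "integrable lborel q" "(\<integral>x. q x \<partial>lborel) \<le> (\<integral>x. p x \<partial>lborel)"
    using LIMSEQ_le[OF L lim_p] le by (auto simp: has_bochner_integral_iff)
qed

lemma gaussian_second_moment_le_euler_op:
  assumes nn: "\<And>x. 0 \<le> f x" and C1: "f C1_differentiable_on UNIV"
    and int: "integrable gaussian f" "integrable gaussian (euler_op f)"
  shows "integrable gaussian (\<lambda>x. f x * x\<^sup>2)"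
    and "(\<integral>x. f x * x\<^sup>2 \<partial>gaussian) \<le> (\<integral>x. euler_op f x \<partial>gaussian) + (\<integral>x. f x \<partial>gaussian)"
proof -
  let ?\<phi> = std_normal_density
  have d: "(f has_real_derivative deriv f x) (at x)" for x
    using C1 by (simp add: C1_differentiable_on_eq DERIV_deriv_iff_real_differentiable)
  have cd: "continuous_on UNIV (deriv f)"
  proof -
    obtain D where D: "\<And>x. (f has_vector_derivative D x) (at x)" "continuous_on UNIV D"
      using C1 by (auto simp: C1_differentiable_on_def)
    have "D = deriv f"
      using D(1) by (intro ext DERIV_imp_deriv[symmetric])
        (simp add: has_real_derivative_iff_has_vector_derivative)
    with D(2) show ?thesis by simp
  qed
  have cf: "continuous_on UNIV f"
    using d by (intro continuous_at_imp_continuous_on) (auto intro: DERIV_isCont)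
  have c\<phi>: "continuous_on UNIV ?\<phi>"
    unfolding std_normal_density_def by (intro continuous_intros) auto
  have [measurable]: "f \<in> borel_measurable borel" "euler_op f \<in> borel_measurable borel"
    using cf cd unfolding euler_op_def
    by (auto intro!: borel_measurable_continuous_onI continuous_intros)
  have d\<phi>: "(?\<phi> has_real_derivative - x * ?\<phi> x) (at x)" for x
    unfolding std_normal_density_def by (auto intro!: derivative_eq_intros simp: field_simps)
  let ?p = "\<lambda>x. ?\<phi> x * euler_op f x + ?\<phi> x * f x"
  let ?q = "\<lambda>x. ?\<phi> x * (f x * x\<^sup>2)"
  \<comment> \<open>Since the derivative of \<open>?\<phi>\<close> is
    \<open>- x * ?\<phi> x\<close>, the product rule gives \<open>?p - ?q\<close>. The factor
    \<open>x\<close> gives \<open>?F\<close> the sign of its argument, whence the boundary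
    condition.\<close>
  let ?F = "\<lambda>x. x * f x * ?\<phi> x"
  have ip: "integrable lborel (\<lambda>x. ?\<phi> x * euler_op f x)" "integrable lborel (\<lambda>x. ?\<phi> x * f x)"
    using int by (simp_all add: integrable_gaussian_iff)
  have F: "(?F has_real_derivative ?p x - ?q x) (at x)" for x
    by (rule derivative_eq_intros d d\<phi> refl)+ (simp add: euler_op_def algebra_simps power2_eq_square)
  have bd: "?F (- r) \<le> ?F r" if "0 \<le> r" for r
  proof -
    have "?F (- r) \<le> 0" "0 \<le> ?F r" using that nn by (auto intro!: mult_nonneg_nonneg)
    then show ?thesis by linarith
  qed
  have cp: "continuous_on UNIV ?p" and cq: "continuous_on UNIV ?q"
    unfolding euler_op_def by (intro continuous_intros cf cd c\<phi>)+
  note FTC = integrable_of_FTC[of ?p ?q ?F, OF Bochner_Integration.integrable_add[OF ip] cp _ cq F bd]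
  show "integrable gaussian (\<lambda>x. f x * x\<^sup>2)"
    using FTC(1) nn by (simp add: integrable_gaussian_iff)
  show "(\<integral>x. f x * x\<^sup>2 \<partial>gaussian) \<le> (\<integral>x. euler_op f x \<partial>gaussian) + (\<integral>x. f x \<partial>gaussian)"
    using FTC(2) nn ip by (simp add: integral_gaussian)
qed

section \<open>The entropy bound by transport to the Gaussian\<close>

theorem theorem5p8:
  fixes f :: "real \<Rightarrow> real"
  assumes "\<And>x. 0 \<le> f x"
    and "log_subharmonic f"
    and "f C1_differentiable_on UNIV"
    and "integrable gaussian f"
    and "integrable gaussian (euler_op f)"
    and "integrable gaussian (\<lambda>x. f x * \<bar>ln (f x)\<bar>)"
  shows "(\<integral>x. f x * ln (f x) \<partial>gaussian) - L1_norm gaussian f * ln (L1_norm gaussian f)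
           \<le> 1 / 2 * (\<integral>x. euler_op f x \<partial>gaussian)"
proof -
  let ?\<phi> = std_normal_density
  interpret \<gamma>: strict_cdf gaussian by (rule strict_cdf_gaussian)
  have pos: "0 < f x" for x
    using assms(2) elog_pos_of_subharmonic by (auto simp: log_subharmonic_def)
  have d: "(f has_real_derivative deriv f x) (at x)" for x
    using assms(3) by (simp add: C1_differentiable_on_eq DERIV_deriv_iff_real_differentiable)
  have "continuous_on UNIV f"
    using d by (intro continuous_at_imp_continuous_on) (auto intro: DERIV_isCont)
  then have [measurable]: "f \<in> borel_measurable borel" by (rule borel_measurable_continuous_onI)
  define Z where "Z = (\<integral>x. f x \<partial>gaussian)"
  have "L1_norm gaussian f = Z" by (simp add: L1_norm_def Z_def assms(1))
  have "Z \<noteq> 0"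
  proof
    assume "Z = 0"
    then have "AE x in gaussian. f x = 0"
      unfolding Z_def using assms by (subst (asm) integral_nonneg_eq_0_iff_AE) auto
    then have "AE x in gaussian. False" by eventually_elim (use pos in \<open>auto simp: less_le\<close>)
    then show False by simp
  qed
  moreover have "0 \<le> Z" unfolding Z_def using assms(1) by (intro integral_nonneg_AE) auto
  ultimately have Z: "0 < Z" by simp
  define g where "g x = ?\<phi> x * f x / Z" for x
  have [measurable]: "g \<in> borel_measurable borel" unfolding g_def by measurable
  have g_pos: "0 < g x" for x using pos Z by (simp add: g_def normal_density_pos)
  have g_int: "integrable lborel g" and g1: "(\<integral>x. g x \<partial>lborel) = 1"
    using assms(4) Z unfolding g_def
    by (auto simp: integrable_gaussian_iff integral_gaussian Z_def)
  define \<mu> where "\<mu> = density lborel g"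
  have "prob_space \<mu>"
    unfolding \<mu>_def using g_int g1 g_pos
    by (intro prob_spaceI) (simp add: emeasure_density nn_integral_eq_integral less_imp_le)
  then interpret \<mu>: strict_cdf \<mu> unfolding \<mu>_def by (intro strict_cdf_density) (auto simp: g_pos)
  \<comment> \<open>Dictionary between \<open>\<mu>\<close> and \<open>gaussian\<close>: the density
    of the former relative to the latter is \<open>f / Z\<close>.\<close>
  have int_\<mu>: "integrable \<mu> h \<longleftrightarrow> integrable gaussian (\<lambda>x. f x * h x)"
    and integral_\<mu>: "(\<integral>x. h x \<partial>\<mu>) = (\<integral>x. f x * h x \<partial>gaussian) / Z"
    if [measurable]: "h \<in> borel_measurable borel" for h
  proof -
    have *: "g x * h x = inverse Z * (?\<phi> x * (f x * h x))" for x by (simp add: g_def divide_inverse)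
    show "integrable \<mu> h \<longleftrightarrow> integrable gaussian (\<lambda>x. f x * h x)"
      unfolding \<mu>_def using Z g_pos
      by (subst integrable_density) (auto simp: less_imp_le * integrable_gaussian_iff)
    show "(\<integral>x. h x \<partial>\<mu>) = (\<integral>x. f x * h x \<partial>gaussian) / Z"
      unfolding \<mu>_def using Z g_pos
      by (subst integral_density) (auto simp: less_imp_le * integral_gaussian divide_inverse)
  qed
  obtain T where T [measurable]: "T \<in> borel_measurable borel"
    and cdf_T: "\<And>x. cdf gaussian (T x) = cdf \<mu> x" and distr_T: "distr \<mu> borel T = gaussian"
    using cdf_transport[OF \<mu>.strict_cdf_axioms \<gamma>.strict_cdf_axioms] by blast
  text \<open>Since \<open>g x = \<phi> (T x) * T' x\<close>, this says that \<open>T\<close> is a contraction.\<close>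
  have contraction: "g x \<le> ?\<phi> (T x)" for x
  proof (rule density_le_std_normal_density[where g = g and x = x and t = "T x" and s = "x - deriv f x / f x"])
    \<comment> \<open>The slope of \<open>ln g\<close> at \<open>x\<close> is
      \<open>deriv f x / f x - x\<close>, so \<open>s\<close> is its negative. The bound multiplies
      the exponential minorant of \<open>f\<close> by the exact shift formula for
      \<open>?\<phi>\<close>.\<close>
    show "g x * exp (- (x - deriv f x / f x) * h - h\<^sup>2 / 2) \<le> g (x + h)" for h
    proof -
      have "f x * exp (deriv f x / f x * h) \<le> f (x + h)"
        by (rule log_subharmonic_above_exp_tangent) (use assms d in auto)
      then have "?\<phi> (x + h) / Z * (f x * exp (deriv f x / f x * h)) \<le> ?\<phi> (x + h) / Z * f (x + h)"
        using Z by (intro mult_left_mono) auto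
      moreover have "exp (- (x - deriv f x / f x) * h - h\<^sup>2 / 2)
          = exp (- x * h - h\<^sup>2 / 2) * exp (deriv f x / f x * h)"
        by (simp add: exp_add[symmetric] algebra_simps)
      ultimately show ?thesis by (simp add: g_def std_normal_density_shift[of x h] mult_ac)
    qed
    show "measure (density lborel g) {..<x} = measure gaussian {..<T x}"
      using \<mu>.measure_lessThan \<gamma>.measure_lessThan cdf_T by (simp add: \<mu>_def)
    show "measure (density lborel g) {x<..} = measure gaussian {T x<..}"
      using \<mu>.measure_greaterThan \<gamma>.measure_greaterThan cdf_T by (simp add: \<mu>_def)
  qed (use g_int g_pos in \<open>auto simp: less_imp_le\<close>)
  \<comment> \<open>Logarithms of \<open>contraction\<close>; the normalising constants of the two
    Gaussian factors cancel.\<close>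
  have pointwise: "ln (f x) - ln Z \<le> x\<^sup>2 / 2 - (T x)\<^sup>2 / 2" for x
  proof -
    have "ln (g x) \<le> ln (?\<phi> (T x))" using contraction[of x] g_pos[of x] by (simp add: normal_density_pos)
    moreover have "ln (?\<phi> y) = ln (1 / sqrt (2 * pi)) - y\<^sup>2 / 2" for y
      unfolding std_normal_density_def by (subst ln_mult) auto
    moreover have "ln (g x) = ln (?\<phi> x) + ln (f x) - ln Z"
      using pos[of x] Z normal_density_pos[of 1 0 x] by (simp add: g_def ln_mult ln_div)
    ultimately show ?thesis by simp
  qed
  note moment = gaussian_second_moment_le_euler_op[OF assms(1,3-5)]
  have "integrable gaussian (\<lambda>x. f x * ln (f x))"
    by (rule Bochner_Integration.integrable_bound[OF assms(6)])
       (auto simp: gaussian_def abs_mult assms(1))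
  then have i_ln: "integrable \<mu> (\<lambda>x. ln (f x))" by (simp add: int_\<mu>)
  have i_sq: "integrable \<mu> (\<lambda>x. x\<^sup>2)" using moment(1) by (simp add: int_\<mu>)
  \<comment> \<open>Change of variables: under \<open>\<mu>\<close>, \<open>T\<close> has the
    standard Gaussian law.\<close>
  have i_T: "integrable \<mu> (\<lambda>x. (T x)\<^sup>2)" and T1: "(\<integral>x. (T x)\<^sup>2 \<partial>\<mu>) = 1"
    using gaussian_second_moment unfolding distr_T[symmetric]
    by (auto simp: integrable_distr_eq integral_distr)
  have "(\<integral>x. ln (f x) - ln Z \<partial>\<mu>) \<le> (\<integral>x. x\<^sup>2 / 2 - (T x)\<^sup>2 / 2 \<partial>\<mu>)"
    using i_ln i_sq i_T pointwise by (intro integral_mono) auto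
  then have "(\<integral>x. ln (f x) \<partial>\<mu>) - ln Z \<le> (\<integral>x. x\<^sup>2 \<partial>\<mu>) / 2 - 1 / 2"
    using i_ln i_sq i_T T1 \<mu>.prob_space by simp
  then have "(\<integral>x. f x * ln (f x) \<partial>gaussian) / Z - ln Z \<le> (\<integral>x. f x * x\<^sup>2 \<partial>gaussian) / Z / 2 - 1 / 2"
    by (simp add: integral_\<mu>)
  then have "Z * ((\<integral>x. f x * ln (f x) \<partial>gaussian) / Z - ln Z)
      \<le> Z * ((\<integral>x. f x * x\<^sup>2 \<partial>gaussian) / Z / 2 - 1 / 2)"
    using Z by (intro mult_left_mono) auto
  then have "(\<integral>x. f x * ln (f x) \<partial>gaussian) - Z * ln Z \<le> (\<integral>x. f x * x\<^sup>2 \<partial>gaussian) / 2 - Z / 2"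
    using Z by (simp add: right_diff_distrib)
  \<comment> \<open>\<open>moment(2)\<close> bounds the second moment by the integral of
    \<open>euler_op f\<close> plus \<open>Z\<close>, and this \<open>Z\<close> cancels the term
    \<open>- Z / 2\<close>.\<close>
  then show ?thesis
    using moment(2) \<open>L1_norm gaussian f = Z\<close> by (simp add: Z_def)
qed

end
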